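(* Let $(M,P,g)$ be a $\mathcal{W}_1$-manifold and let $\nabla'$ be a natural connection on it, determined by a pair of real parameters $(\lambda,\mu)$, with torsion $T$. Then $\nabla'$ has a parallel torsion (i.e. $\nabla'T=0$) if and only if the 1-form $\theta$ is parallel with respect to $\nabla'$ (i.e. $\nabla'\theta=0$).
   Context: Setting. A Riemannian almost product manifold $(M,P,g)$ is a differentiable manifold $M$ with a $(1,1)$-tensor field $P$ and a Riemannian metric $g$ such that $P^2x=x$ and $g(Px,Py)=g(x,y)$. Throughout $\operatorname{tr}P=0$ and $\dim M=2n$; $x,y,z$ are arbitrary smooth vector fields (or tangent vectors). Let $\nabla$ be the Levi-Civita connection of $g$, $F(x,y,z)=g((\nabla_xP)y,z)$, and $\theta(x)=g^{ij}F(e_i,e_j,x)$, where $\{e_i\}$ is a basis of the tangent space and $(g^{ij})$ is the inverse matrix of $(g(e_i,e_j))$. $(M,P,g)$ is a $\mathcal{W}_1$-manifold if $$F(x,y,z)=\tfrac{1}{2n}\{g(x,y)\theta(z)-g(x,Py)\theta(Pz)+g(x,z)\theta(y)-g(x,Pz)\theta(Py)\}.$$ The vector field $\Omega$ is defined by $g(\Omega,x)=\theta(x)$. Natural connections. A linear connection $\nabla'$ is natural if $\nabla'P=\nabla'g=0$. The natural connections considered on a $\mathcal{W}_1$-manifold form a 2-parametric family with parameters $\lambda,\mu\in\mathbb{R}$; the one determined by $(\lambda,\mu)$ is $$\nabla'_xy=\nabla_xy+g(x,Py)\{\lambda P\Omega+\mu\Omega\}-\{\lambda\theta(Py)+\mu\theta(y)\}Px+g(x,y)\{\lambda\Omega+(\mu+\tfrac1{2n})P\Omega\}-\{\lambda\theta(y)+(\mu+\tfrac1{2n})\theta(Py)\}x.$$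 Its torsion is $T(x,y)=\nabla'_xy-\nabla'_yx-[x,y]$, and $T(x,y,z)=g(T(x,y),z)$ is $$\begin{aligned}T(x,y,z)=&\tfrac1{2n}\{g(y,z)\theta(Px)-g(x,z)\theta(Py)\}+\lambda\{g(y,z)\theta(x)-g(x,z)\theta(y)+g(y,Pz)\theta(Px)-g(x,Pz)\theta(Py)\}\\&+\mu\{g(y,Pz)\theta(x)-g(x,Pz)\theta(y)+g(y,z)\theta(Px)-g(x,z)\theta(Py)\}.\end{aligned}$$ *)

theory Defs
  imports "HOL-Analysis.Analysis" "HOL-Library.Function_Algebras"
begin

section \<open>Smooth manifolds, tangent vectors and vector fields\<close>

(* Sums and differences of functions, tangent vectors and vector fields are the pointwise ones
   of Function_Algebras. *)

primrec Ck_on :: "nat \<Rightarrow> 'a::euclidean_space set \<Rightarrow> ('a \<Rightarrow> 'b::euclidean_space) \<Rightarrow> bool" where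
  "Ck_on 0 S f \<longleftrightarrow> continuous_on S f"
| "Ck_on (Suc k) S f \<longleftrightarrow>
     (\<forall>x\<in>S. f differentiable at x) \<and> (\<forall>v. Ck_on k S (\<lambda>x. frechet_derivative f (at x) v))"

(* Only used for open S. *)
definition smooth_on :: "'a::euclidean_space set \<Rightarrow> ('a \<Rightarrow> 'b::euclidean_space) \<Rightarrow> bool" where
  "smooth_on S f \<longleftrightarrow> (\<forall>k. Ck_on k S f)"

(* A chart is a pair (U, phi); its inverse is inv_into U phi.  The manifold is the whole type 'a,
   modelled on real ^ 'n; it is Hausdorff and second countable through the sort of 'a. *)
type_synonym ('a, 'n) atlas = "('a set \<times> ('a \<Rightarrow> real ^ 'n)) set"

definition smooth_atlas ::
  "('a::{second_countable_topology, t2_space}, 'n::finite) atlas \<Rightarrow> bool" where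
  "smooth_atlas A \<longleftrightarrow>
     (\<Union>(U, \<phi>)\<in>A. U) = UNIV \<and>
     (\<forall>(U, \<phi>)\<in>A. open U \<and> open (\<phi> ` U) \<and> homeomorphism U (\<phi> ` U) \<phi> (inv_into U \<phi>)) \<and>
     (\<forall>(U, \<phi>)\<in>A. \<forall>(V, \<psi>)\<in>A. smooth_on (\<phi> ` (U \<inter> V)) (\<psi> \<circ> inv_into U \<phi>))"

definition smooth_fun :: "('a, 'n::finite) atlas \<Rightarrow> ('a \<Rightarrow> real) \<Rightarrow> bool" where
  "smooth_fun A f \<longleftrightarrow> (\<forall>(U, \<phi>)\<in>A. smooth_on (\<phi> ` U) (f \<circ> inv_into U \<phi>))"

(* A tangent vector at p is the operator sum_i w_i d/dx_i at p on smooth functions, in the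
   coordinates of a chart around p.  It is extended by 0 to functions that are not smooth, so
   that equality of tangent vectors is equality on smooth functions. *)
type_synonym 'a tvec = "('a \<Rightarrow> real) \<Rightarrow> real"

definition tangent_space :: "('a, 'n::finite) atlas \<Rightarrow> 'a \<Rightarrow> 'a tvec set" where
  "tangent_space A p =
     {v. \<exists>(U, \<phi>)\<in>A. p \<in> U \<and>
        (\<exists>w. v = (\<lambda>f. if smooth_fun A f
                      then frechet_derivative (f \<circ> inv_into U \<phi>) (at (\<phi> p)) w else 0))}"

definition tscale :: "real \<Rightarrow> 'a tvec \<Rightarrow> 'a tvec" (infixr "*\<^sub>t" 75) where
  "c *\<^sub>t v = (\<lambda>f. c * v f)"

definition tangent_basis :: "('a, 'n::finite) atlas \<Rightarrow> 'a \<Rightarrow> ('n \<Rightarrow> 'a tvec) \<Rightarrow> bool" where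
  "tangent_basis A p e \<longleftrightarrow>
     (\<forall>i. e i \<in> tangent_space A p) \<and>
     (\<forall>v\<in>tangent_space A p. \<exists>!c :: real ^ 'n. v = (\<Sum>i\<in>UNIV. (c $ i) *\<^sub>t e i))"

type_synonym 'a vfield = "'a \<Rightarrow> 'a tvec"

definition deriv_along :: "'a vfield \<Rightarrow> ('a \<Rightarrow> real) \<Rightarrow> 'a \<Rightarrow> real" where
  "deriv_along X f = (\<lambda>p. X p f)"

definition vector_field :: "('a, 'n::finite) atlas \<Rightarrow> 'a vfield \<Rightarrow> bool" where
  "vector_field A X \<longleftrightarrow>
     (\<forall>p. X p \<in> tangent_space A p) \<and>
     (\<forall>f. smooth_fun A f \<longrightarrow> smooth_fun A (deriv_along X f))"

definition fscale :: "('a \<Rightarrow> real) \<Rightarrow> 'a vfield \<Rightarrow> 'a vfield" (infixr "*\<^sub>v" 75) where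
  "h *\<^sub>v X = (\<lambda>p. h p *\<^sub>t X p)"

definition lie_bracket :: "('a, 'n::finite) atlas \<Rightarrow> 'a vfield \<Rightarrow> 'a vfield \<Rightarrow> 'a vfield" where
  "lie_bracket A X Y =
     (\<lambda>p f. if smooth_fun A f then X p (deriv_along Y f) - Y p (deriv_along X f) else 0)"


section \<open>Riemannian almost product manifolds\<close>

(* Tensor fields are families of (multi)linear maps on the tangent spaces; pair and app are their
   actions on vector fields. *)

type_synonym 'a metric = "'a \<Rightarrow> 'a tvec \<Rightarrow> 'a tvec \<Rightarrow> real"
type_synonym 'a endo = "'a \<Rightarrow> 'a tvec \<Rightarrow> 'a tvec"

definition pair :: "'a metric \<Rightarrow> 'a vfield \<Rightarrow> 'a vfield \<Rightarrow> 'a \<Rightarrow> real" where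
  "pair g X Y = (\<lambda>p. g p (X p) (Y p))"

definition app :: "'a endo \<Rightarrow> 'a vfield \<Rightarrow> 'a vfield" where
  "app P X = (\<lambda>p. P p (X p))"

definition riemannian_metric :: "('a, 'n::finite) atlas \<Rightarrow> 'a metric \<Rightarrow> bool" where
  "riemannian_metric A g \<longleftrightarrow>
     (\<forall>p. \<forall>u\<in>tangent_space A p. \<forall>v\<in>tangent_space A p. \<forall>w\<in>tangent_space A p. \<forall>c.
        g p (u + v) w = g p u w + g p v w \<and>
        g p (c *\<^sub>t u) w = c * g p u w \<and>
        g p u v = g p v u \<and>
        (u \<noteq> 0 \<longrightarrow> g p u u > 0)) \<and>
     (\<forall>X Y. vector_field A X \<longrightarrow> vector_field A Y \<longrightarrow> smooth_fun A (pair g X Y))"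

definition endo_field :: "('a, 'n::finite) atlas \<Rightarrow> 'a endo \<Rightarrow> bool" where
  "endo_field A P \<longleftrightarrow>
     (\<forall>p. \<forall>u\<in>tangent_space A p. \<forall>v\<in>tangent_space A p. \<forall>c.
        P p u \<in> tangent_space A p \<and>
        P p (u + v) = P p u + P p v \<and>
        P p (c *\<^sub>t u) = c *\<^sub>t P p u) \<and>
     (\<forall>X. vector_field A X \<longrightarrow> vector_field A (app P X))"

definition traceless :: "('a, 'n::finite) atlas \<Rightarrow> 'a endo \<Rightarrow> bool" where
  "traceless A P \<longleftrightarrow>
     (\<forall>p e. \<forall>M :: real ^ 'n ^ 'n.
        tangent_basis A p e \<and> (\<forall>j. P p (e j) = (\<Sum>i\<in>UNIV. (M $ i $ j) *\<^sub>t e i))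
        \<longrightarrow> trace M = 0)"

definition riemannian_almost_product_manifold ::
  "('a::{second_countable_topology, t2_space}, 'n::finite) atlas \<Rightarrow> 'a endo \<Rightarrow> 'a metric \<Rightarrow> bool"
where
  "riemannian_almost_product_manifold A P g \<longleftrightarrow>
     smooth_atlas A \<and> riemannian_metric A g \<and> endo_field A P \<and>
     (\<forall>p. \<forall>u\<in>tangent_space A p. \<forall>v\<in>tangent_space A p.
        P p (P p u) = u \<and> g p (P p u) (P p v) = g p u v) \<and>
     traceless A P"


section \<open>Linear connections\<close>

type_synonym 'a connection = "'a vfield \<Rightarrow> 'a vfield \<Rightarrow> 'a vfield"

definition linear_connection :: "('a, 'n::finite) atlas \<Rightarrow> 'a connection \<Rightarrow> bool" where
  "linear_connection A D \<longleftrightarrow>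
     (\<forall>X Y Z f. vector_field A X \<longrightarrow> vector_field A Y \<longrightarrow> vector_field A Z \<longrightarrow> smooth_fun A f \<longrightarrow>
        vector_field A (D X Y) \<and>
        D (X + Y) Z = D X Z + D Y Z \<and>
        D (f *\<^sub>v X) Y = f *\<^sub>v D X Y \<and>
        D X (Y + Z) = D X Y + D X Z \<and>
        D X (f *\<^sub>v Y) = deriv_along X f *\<^sub>v Y + f *\<^sub>v D X Y)"

(* The covariant derivative of a field of endomorphisms, of the metric, of a 1-form and of a
   vector-valued (1,2)-tensor.  One-forms and (1,2)-tensors are given by their actions on vector
   fields. *)

definition cov_endo :: "'a connection \<Rightarrow> 'a endo \<Rightarrow> 'a vfield \<Rightarrow> 'a vfield \<Rightarrow> 'a vfield" where
  "cov_endo D P X Y = D X (app P Y) - app P (D X Y)"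

definition cov_metric ::
  "'a connection \<Rightarrow> 'a metric \<Rightarrow> 'a vfield \<Rightarrow> 'a vfield \<Rightarrow> 'a vfield \<Rightarrow> 'a \<Rightarrow> real" where
  "cov_metric D g X Y Z =
     deriv_along X (pair g Y Z) - pair g (D X Y) Z - pair g Y (D X Z)"

definition cov_form ::
  "'a connection \<Rightarrow> ('a vfield \<Rightarrow> 'a \<Rightarrow> real) \<Rightarrow> 'a vfield \<Rightarrow> 'a vfield \<Rightarrow> 'a \<Rightarrow> real" where
  "cov_form D \<theta> X Y = deriv_along X (\<theta> Y) - \<theta> (D X Y)"

definition cov_tensor12 ::
  "'a connection \<Rightarrow> ('a vfield \<Rightarrow> 'a vfield \<Rightarrow> 'a vfield) \<Rightarrow>
   'a vfield \<Rightarrow> 'a vfield \<Rightarrow> 'a vfield \<Rightarrow> 'a vfield" where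
  "cov_tensor12 D T W X Y = D W (T X Y) - T (D W X) Y - T X (D W Y)"

definition parallel_endo :: "('a, 'n::finite) atlas \<Rightarrow> 'a connection \<Rightarrow> 'a endo \<Rightarrow> bool" where
  "parallel_endo A D P \<longleftrightarrow>
     (\<forall>X Y. vector_field A X \<longrightarrow> vector_field A Y \<longrightarrow> cov_endo D P X Y = 0)"

definition parallel_metric :: "('a, 'n::finite) atlas \<Rightarrow> 'a connection \<Rightarrow> 'a metric \<Rightarrow> bool" where
  "parallel_metric A D g \<longleftrightarrow>
     (\<forall>X Y Z. vector_field A X \<longrightarrow> vector_field A Y \<longrightarrow> vector_field A Z \<longrightarrow>
        cov_metric D g X Y Z = 0)"

definition parallel_form ::
  "('a, 'n::finite) atlas \<Rightarrow> 'a connection \<Rightarrow> ('a vfield \<Rightarrow> 'a \<Rightarrow> real) \<Rightarrow> bool" where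
  "parallel_form A D \<theta> \<longleftrightarrow>
     (\<forall>X Y. vector_field A X \<longrightarrow> vector_field A Y \<longrightarrow> cov_form D \<theta> X Y = 0)"

definition parallel_tensor12 ::
  "('a, 'n::finite) atlas \<Rightarrow> 'a connection \<Rightarrow> ('a vfield \<Rightarrow> 'a vfield \<Rightarrow> 'a vfield) \<Rightarrow> bool" where
  "parallel_tensor12 A D T \<longleftrightarrow>
     (\<forall>W X Y. vector_field A W \<longrightarrow> vector_field A X \<longrightarrow> vector_field A Y \<longrightarrow>
        cov_tensor12 D T W X Y = 0)"

definition torsion ::
  "('a, 'n::finite) atlas \<Rightarrow> 'a connection \<Rightarrow> 'a vfield \<Rightarrow> 'a vfield \<Rightarrow> 'a vfield" where
  "torsion A D X Y = D X Y - D Y X - lie_bracket A X Y"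

definition levi_civita :: "('a, 'n::finite) atlas \<Rightarrow> 'a metric \<Rightarrow> 'a connection \<Rightarrow> bool" where
  "levi_civita A g D \<longleftrightarrow>
     linear_connection A D \<and> parallel_metric A D g \<and>
     (\<forall>X Y. vector_field A X \<longrightarrow> vector_field A Y \<longrightarrow> torsion A D X Y = 0)"

definition natural_connection ::
  "('a, 'n::finite) atlas \<Rightarrow> 'a endo \<Rightarrow> 'a metric \<Rightarrow> 'a connection \<Rightarrow> bool" where
  "natural_connection A P g D \<longleftrightarrow>
     linear_connection A D \<and> parallel_endo A D P \<and> parallel_metric A D g"


section \<open>The tensor F, its Lee form and the class W1\<close>

definition tensor_F ::
  "'a connection \<Rightarrow> 'a endo \<Rightarrow> 'a metric \<Rightarrow> 'a vfield \<Rightarrow> 'a vfield \<Rightarrow> 'a vfield \<Rightarrow> 'a \<Rightarrow> real" where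
  "tensor_F D P g X Y Z = pair g (cov_endo D P X Y) Z"

definition frame_at :: "('a, 'n::finite) atlas \<Rightarrow> 'a \<Rightarrow> ('n \<Rightarrow> 'a vfield) \<Rightarrow> bool" where
  "frame_at A p E \<longleftrightarrow> (\<forall>i. vector_field A (E i)) \<and> tangent_basis A p (\<lambda>i. E i p)"

(* theta(X) = g^{ij} F(e_i, e_j, X) at p.  The basis vectors e_i of the tangent space at p are
   taken as values at p of vector fields E i, on which F is defined.  As F is tensorial, the
   result does not depend on the choice of E. *)
definition lee_form ::
  "('a, 'n::finite) atlas \<Rightarrow> 'a endo \<Rightarrow> 'a metric \<Rightarrow> 'a connection \<Rightarrow> 'a vfield \<Rightarrow> 'a \<Rightarrow> real" where
  "lee_form A P g D X = (\<lambda>p.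
     let E = (SOME E. frame_at A p E);
         G = matrix_inv ((\<chi> i j. g p (E i p) (E j p)) :: real ^ 'n ^ 'n)
     in \<Sum>i\<in>UNIV. \<Sum>j\<in>UNIV. G $ i $ j * tensor_F D P g (E i) (E j) X p)"

definition W1_manifold ::
  "('a::{second_countable_topology, t2_space}, 'n::finite) atlas \<Rightarrow> 'a endo \<Rightarrow> 'a metric \<Rightarrow>
   'a connection \<Rightarrow> nat \<Rightarrow> bool" where
  "W1_manifold A P g D n \<longleftrightarrow>
     riemannian_almost_product_manifold A P g \<and> CARD('n) = 2 * n \<and> levi_civita A g D \<and>
     (\<forall>X Y Z p. vector_field A X \<longrightarrow> vector_field A Y \<longrightarrow> vector_field A Z \<longrightarrow>
        (let \<theta> = lee_form A P g D in
         tensor_F D P g X Y Z p =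
           1 / (2 * real n) *
             (pair g X Y p * \<theta> Z p - pair g X (app P Y) p * \<theta> (app P Z) p +
              pair g X Z p * \<theta> Y p - pair g X (app P Z) p * \<theta> (app P Y) p)))"

definition dual_field ::
  "('a, 'n::finite) atlas \<Rightarrow> 'a metric \<Rightarrow> ('a vfield \<Rightarrow> 'a \<Rightarrow> real) \<Rightarrow> 'a vfield \<Rightarrow> bool" where
  "dual_field A g \<theta> \<Omega> \<longleftrightarrow>
     vector_field A \<Omega> \<and> (\<forall>X. vector_field A X \<longrightarrow> pair g \<Omega> X = \<theta> X)"

(* The member of the 2-parametric family with parameters a (lambda) and b (mu). *)
definition family_connection ::
  "'a endo \<Rightarrow> 'a metric \<Rightarrow> 'a connection \<Rightarrow> nat \<Rightarrow> ('a vfield \<Rightarrow> 'a \<Rightarrow> real) \<Rightarrow> 'a vfield \<Rightarrow>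
   real \<Rightarrow> real \<Rightarrow> 'a connection" where
  "family_connection P g D n \<theta> \<Omega> a b X Y =
     (let c = b + 1 / (2 * real n) in
      D X Y
      + pair g X (app P Y) *\<^sub>v ((\<lambda>_. a) *\<^sub>v app P \<Omega> + (\<lambda>_. b) *\<^sub>v \<Omega>)
      - (\<lambda>p. a * \<theta> (app P Y) p + b * \<theta> Y p) *\<^sub>v app P X
      + pair g X Y *\<^sub>v ((\<lambda>_. a) *\<^sub>v \<Omega> + (\<lambda>_. c) *\<^sub>v app P \<Omega>)
      - (\<lambda>p. a * \<theta> Y p + c * \<theta> (app P Y) p) *\<^sub>v X)"

end

theory Submission
  imports Defs
begin

text \<open>For a connection of the family the torsion is, with \<open>c = b + 1/(2n)\<close>,

  \<open>T(X, Y) = (a \<theta>(P X) + b \<theta>(X)) P Y + (a \<theta>(X) + c \<theta>(P X)) Y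
    - (a \<theta>(P Y) + b \<theta>(Y)) P X - (a \<theta>(Y) + c \<theta>(P Y)) X\<close>

  (\<open>torsion_family_connection\<close>). Since \<open>P\<close> is parallel for the connection, the covariant derivative
  of \<open>T\<close> along \<open>W\<close> is the same expression with \<open>\<theta>\<close> replaced by its covariant derivative \<open>\<eta>\<close> along
  \<open>W\<close> (\<open>cov_W1_torsion\<close>). Hence a parallel \<open>\<theta>\<close> gives a parallel torsion.

  Conversely, let \<open>T\<close> be parallel. A contraction of \<open>T\<close> gives a combination of \<open>\<theta>\<close> and
  \<open>\<theta> \<circ> P\<close> whose coefficients depend on \<open>a\<close> and \<open>b\<close> and need not determine \<open>\<theta>\<close>. The tensor
  \<open>T(P X, Y) - P (T(X, Y)) = {\<theta>(X) Y - \<theta>(P X) P Y} / (2n)\<close> is free of the parameters. Applied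
  to \<open>\<eta>\<close>, this shows \<open>\<eta>(X) Y = \<eta>(P X) P Y\<close> for all vector fields \<open>X\<close> and \<open>Y\<close>
  (\<open>W1_torsion_zero_imp\<close>). If \<open>\<eta>(X)\<close> were nonzero at a point, \<open>P\<close> would be a multiple of the
  identity on the tangent space there, which an endomorphism with \<open>P\<^sup>2 = 1\<close> and trace zero is not
  (\<open>scaled_tangent_vectors_eq_imp_zero\<close>).

  This last step needs every tangent vector to be the value of a global vector field
  (\<open>tangent_vector_extends\<close>) and every tangent space to have a basis (\<open>tangent_basis_exists\<close>). Both
  rest on bump functions, and so on a calculus of C^k functions with products and compositions and
  on the flat function \<open>exp (- 1 / t)\<close>.\<close>

section \<open>Calculus of functions of class C^k\<close>

lemma Ck_on_Suc_imp: "Ck_on (Suc k) S f \<Longrightarrow> Ck_on k S f"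
proof (induction k arbitrary: f)
  case 0
  then show ?case
    by (auto intro!: continuous_at_imp_continuous_on differentiable_imp_continuous_within)
qed auto

lemma Ck_on_subset: "Ck_on k S f \<Longrightarrow> T \<subseteq> S \<Longrightarrow> Ck_on k T f"
  by (induction k arbitrary: f) (auto intro: continuous_on_subset)

lemma Ck_on_differentiable: "Ck_on (Suc k) S f \<Longrightarrow> x \<in> S \<Longrightarrow> (f has_derivative frechet_derivative f (at x)) (at x)"
  by (simp add: frechet_derivative_works)

lemma Ck_on_cong:
  assumes "open S" "\<And>x. x \<in> S \<Longrightarrow> f x = g x" "Ck_on k S f"
  shows "Ck_on k S g"
  using assms(2,3)
proof (induction k arbitrary: f g)
  case 0
  then show ?case using continuous_on_cong[of S S f g] by simp
next
  case (Suc k)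
  have g: "(g has_derivative frechet_derivative f (at x)) (at x)" if "x \<in> S" for x
    using Ck_on_differentiable[OF Suc.prems(2) that] \<open>open S\<close> that Suc.prems(1)
    by (rule has_derivative_transform_within_open)
  have eq: "frechet_derivative f (at x) v = frechet_derivative g (at x) v" if "x \<in> S" for x v
    using frechet_derivative_at[OF g[OF that]] by simp
  have "Ck_on k S (\<lambda>x. frechet_derivative g (at x) v)" for v
    by (rule Suc.IH[OF eq]) (use Suc.prems(2) in auto)
  moreover have "\<forall>x\<in>S. g differentiable at x"
    using g unfolding differentiable_def by blast
  ultimately show ?case by simp
qed

lemma Ck_on_local:
  assumes "\<And>x. x \<in> S \<Longrightarrow> \<exists>T. open T \<and> x \<in> T \<and> Ck_on k T f"
  shows "Ck_on k S f"
  using assms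
proof (induction k arbitrary: f)
  case 0
  have "isCont f x" if x: "x \<in> S" for x
  proof -
    obtain T where "open T" "x \<in> T" "Ck_on 0 T f"
      using "0.prems"[OF x] by blast
    then show ?thesis by (simp add: continuous_on_eq_continuous_at)
  qed
  then show ?case by (simp add: continuous_at_imp_continuous_on)
next
  case (Suc k)
  have "f differentiable at x" if "x \<in> S" for x
    using Suc.prems[OF that] by auto
  moreover have "Ck_on k S (\<lambda>x. frechet_derivative f (at x) v)" for v
  proof (rule Suc.IH)
    fix x assume "x \<in> S"
    then obtain T where "open T" "x \<in> T" "Ck_on (Suc k) T f"
      using Suc.prems by blast
    then show "\<exists>T. open T \<and> x \<in> T \<and> Ck_on k T (\<lambda>x. frechet_derivative f (at x) v)"
      by auto
  qed
  ultimately show ?case by simp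
qed

text \<open>The recursion for \<^const>\<open>Ck_on\<close> speaks of the chosen \<^const>\<open>frechet_derivative\<close>; this rule lets one work with
  an explicit formula for the derivative instead, and is the step of every induction below.\<close>
lemma Ck_on_SucI:
  assumes "open S" "\<And>x. x \<in> S \<Longrightarrow> (f has_derivative f' x) (at x)"
    and "\<And>v. Ck_on k S (\<lambda>x. f' x v)"
  shows "Ck_on (Suc k) S f"
proof -
  have "f' x = frechet_derivative f (at x)" if "x \<in> S" for x
    using assms(2)[OF that] by (rule frechet_derivative_at)
  then have "Ck_on k S (\<lambda>x. frechet_derivative f (at x) v)" for v
    by (intro Ck_on_cong[OF assms(1) _ assms(3)]) auto
  moreover have "\<forall>x\<in>S. f differentiable at x"
    using assms(2) unfolding differentiable_def by blast
  ultimately show ?thesis by simp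
qed

lemma Ck_on_const: "Ck_on k S (\<lambda>x. c)"
  by (induction k arbitrary: c) simp_all

lemma Ck_on_add:
  assumes "open S" "Ck_on k S f" "Ck_on k S g"
  shows "Ck_on k S (\<lambda>x. f x + g x)"
  using assms(2,3)
proof (induction k arbitrary: f g)
  case 0 then show ?case by (simp add: continuous_on_add)
next
  case (Suc k)
  show ?case
  proof (rule Ck_on_SucI[OF assms(1)])
    show "((\<lambda>x. f x + g x) has_derivative
        (\<lambda>v. frechet_derivative f (at x) v + frechet_derivative g (at x) v)) (at x)" if "x \<in> S" for x
      using Suc.prems that by (intro has_derivative_add Ck_on_differentiable)
  qed (use Suc in auto)
qed

lemma Ck_on_sum:
  assumes "open S" "\<And>i. i \<in> I \<Longrightarrow> Ck_on k S (f i)"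
  shows "Ck_on k S (\<lambda>x. \<Sum>i\<in>I. f i x)"
  using assms(2)
  by (induction I rule: infinite_finite_induct) (auto intro: Ck_on_const Ck_on_add assms(1))

lemma Ck_on_inner:
  assumes "open S" "Ck_on k S f"
  shows "Ck_on k S (\<lambda>x. f x \<bullet> b)"
  using assms(2)
proof (induction k arbitrary: f)
  case 0 then show ?case by (simp add: continuous_on_inner)
next
  case (Suc k)
  show ?case
  proof (rule Ck_on_SucI[OF assms(1)])
    show "((\<lambda>x. f x \<bullet> b) has_derivative (\<lambda>v. frechet_derivative f (at x) v \<bullet> b)) (at x)"
      if "x \<in> S" for x
      using Suc.prems that by (intro has_derivative_inner_left Ck_on_differentiable)
  qed (use Suc in auto)
qed

lemma Ck_on_mult:
  fixes f g :: "'a::euclidean_space \<Rightarrow> real"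
  assumes "open S" "Ck_on k S f" "Ck_on k S g"
  shows "Ck_on k S (\<lambda>x. f x * g x)"
  using assms(2,3)
proof (induction k arbitrary: f g)
  case 0 then show ?case by (simp add: continuous_on_mult)
next
  case (Suc k)
  show ?case
  proof (rule Ck_on_SucI[OF assms(1)])
    show "((\<lambda>x. f x * g x) has_derivative
        (\<lambda>v. f x * frechet_derivative g (at x) v + frechet_derivative f (at x) v * g x)) (at x)"
      if "x \<in> S" for x
      using Suc.prems that by (intro has_derivative_mult Ck_on_differentiable)
    show "Ck_on k S (\<lambda>x. f x * frechet_derivative g (at x) v + frechet_derivative f (at x) v * g x)" for v
      using Suc.prems Ck_on_Suc_imp by (intro Ck_on_add[OF assms(1)] Suc.IH) auto
  qed
qed

text \<open>The derivative of a composition is rewritten as a finite sum of products of scalar functions,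
  one for each vector of the standard basis of the intermediate space. Each factor
  \<open>Df(g x) b\<close> is again a composition with \<open>g\<close>, of one class less, so the induction on \<open>k\<close> applies
  with \<open>f\<close> arbitrary.\<close>
lemma Ck_on_compose:
  fixes f :: "'b::euclidean_space \<Rightarrow> real" and g :: "'a::euclidean_space \<Rightarrow> 'b"
  assumes "open S" "g ` S \<subseteq> T" "Ck_on k T f" "Ck_on k S g"
  shows "Ck_on k S (\<lambda>x. f (g x))"
  using assms(3,4)
proof (induction k arbitrary: f)
  case 0 then show ?case using continuous_on_compose2[OF _ _ assms(2)] unfolding Ck_on.simps by blast
next
  case (Suc k)
  note d = Ck_on_differentiable[OF Suc.prems(1)]
  show ?case
  proof (rule Ck_on_SucI[OF assms(1)])
    show "((\<lambda>x. f (g x)) has_derivative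
        (\<lambda>v. \<Sum>b\<in>Basis. (frechet_derivative g (at x) v \<bullet> b) * frechet_derivative f (at (g x)) b)) (at x)"
      if "x \<in> S" for x
    proof -
      have gx: "g x \<in> T" using assms(2) that by auto
      interpret linear "frechet_derivative f (at (g x))"
        using d[OF gx] by (rule has_derivative_linear)
      have "frechet_derivative f (at (g x)) (\<Sum>b\<in>Basis. (u \<bullet> b) *\<^sub>R b)
          = (\<Sum>b\<in>Basis. (u \<bullet> b) * frechet_derivative f (at (g x)) b)" for u
        by (simp only: sum scale real_scaleR_def)
      then have eq: "frechet_derivative f (at (g x)) u
          = (\<Sum>b\<in>Basis. (u \<bullet> b) * frechet_derivative f (at (g x)) b)" for u
        unfolding euclidean_representation .
      show ?thesis
        using has_derivative_compose[OF Ck_on_differentiable[OF Suc.prems(2) that] d[OF gx]]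
        unfolding eq[of "frechet_derivative g (at x) _"] .
    qed
    show "Ck_on k S (\<lambda>x. \<Sum>b\<in>Basis. (frechet_derivative g (at x) v \<bullet> b) * frechet_derivative f (at (g x)) b)" for v
    proof (intro Ck_on_sum Ck_on_mult Ck_on_inner Suc.IH assms(1))
      show "Ck_on k S g" by (rule Ck_on_Suc_imp[OF Suc.prems(2)])
    qed (use Suc.prems in simp_all)
  qed
qed

section \<open>A smooth bump function\<close>

text \<open>The powers of \<open>inverse t\<close> make this family of flat functions closed under differentiation up to
  linear combinations, so that smoothness of all of them follows by one induction. The bump function
  uses \<open>m = 0\<close>.\<close>
definition flat :: "nat \<Rightarrow> real \<Rightarrow> real" where
  "flat m t = (if t > 0 then exp (- inverse t) * inverse t ^ m else 0)"

lemma flat_tendsto_0: "(flat m \<longlongrightarrow> 0) (at 0)"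
proof -
  have "((\<lambda>t. (\<lambda>x. x ^ m / exp x) (inverse t)) \<longlongrightarrow> 0) (at_right (0::real))"
    by (rule filterlim_compose[OF tendsto_power_div_exp_0 filterlim_inverse_at_top_right])
  then have "(flat m \<longlongrightarrow> 0) (at_right 0)"
    by (rule Lim_transform_eventually)
      (auto simp: flat_def eventually_at_right_field exp_minus field_simps intro: exI[of _ 1])
  moreover have "(flat m \<longlongrightarrow> 0) (at_left 0)"
    by (rule Lim_transform_eventually[OF tendsto_const])
      (auto simp: flat_def eventually_at_left_field intro: exI[of _ "-1"])
  ultimately show ?thesis by (simp add: filterlim_split_at)
qed

lemma flat_deriv: "(flat m has_real_derivative flat (m + 2) t - m * flat (m + 1) t) (at t)"
proof -
  consider "t > 0" | "t < 0" | "t = 0" by linarith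
  then show ?thesis
  proof cases
    case 1
    have "((\<lambda>t. exp (- inverse t) * inverse t ^ m) has_real_derivative
        exp (- inverse t) * (inverse t)\<^sup>2 * inverse t ^ m
          - exp (- inverse t) * (real m * inverse t ^ (m - 1) * (inverse t)\<^sup>2)) (at t)"
      using 1 by (auto intro!: derivative_eq_intros simp: power2_eq_square algebra_simps)
    moreover have "exp (- inverse t) * (inverse t)\<^sup>2 * inverse t ^ m
          - exp (- inverse t) * (real m * inverse t ^ (m - 1) * (inverse t)\<^sup>2)
        = flat (m + 2) t - m * flat (m + 1) t"
      using 1 by (cases m) (simp_all add: flat_def power2_eq_square algebra_simps)
    ultimately have "((\<lambda>t. exp (- inverse t) * inverse t ^ m) has_real_derivative
        flat (m + 2) t - m * flat (m + 1) t) (at t)"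
      by simp
    then show ?thesis
      by (rule has_field_derivative_transform_within_open[of _ _ _ "{0<..}"])
        (use 1 in \<open>auto simp: flat_def\<close>)
  next
    case 2
    have "((\<lambda>t. 0) has_real_derivative flat (m + 2) t - m * flat (m + 1) t) (at t)"
      using 2 by (simp add: flat_def)
    then show ?thesis
      by (rule has_field_derivative_transform_within_open[of _ _ _ "{..<0}"])
        (use 2 in \<open>auto simp: flat_def\<close>)
  next
    case 3
    have "(\<lambda>h. (flat m (0 + h) - flat m 0) / h) = flat (Suc m)"
      by (auto simp: flat_def fun_eq_iff divide_inverse)
    then show ?thesis
      using 3 flat_tendsto_0[of "Suc m"] by (simp add: DERIV_def flat_def)
  qed
qed

lemma Ck_on_flat: "Ck_on k UNIV (flat m)"
proof (induction k arbitrary: m)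
  case 0
  show ?case by (simp add: continuous_at_imp_continuous_on DERIV_isCont[OF flat_deriv])
next
  case (Suc k)
  show ?case
  proof (rule Ck_on_SucI[OF open_UNIV])
    show "(flat m has_derivative (\<lambda>v. (flat (m + 2) t + (- real m) * flat (m + 1) t) * v)) (at t)" for t
      using flat_deriv[of m t] by (simp add: has_field_derivative_def)
    show "Ck_on k UNIV (\<lambda>t. (flat (m + 2) t + (- real m) * flat (m + 1) t) * v)" for v
      by (intro Ck_on_mult Ck_on_add Ck_on_const Suc.IH open_UNIV)
  qed
qed

lemma Ck_on_id: "Ck_on k S (\<lambda>x. x)"
proof (cases k)
  case (Suc j)
  then show ?thesis
    using Ck_on_const Ck_on_subset[of k UNIV _ S]
    by (auto simp: continuous_on_id intro!: Ck_on_SucI[OF open_UNIV has_derivative_ident])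
qed (simp add: continuous_on_id)

definition bump :: "'a::euclidean_space \<Rightarrow> real \<Rightarrow> 'a \<Rightarrow> real" where
  "bump x r y = flat 0 (r\<^sup>2 - (y - x) \<bullet> (y - x))"

lemma bump_center: "r > 0 \<Longrightarrow> bump x r x > 0"
  by (simp add: bump_def flat_def)

lemma bump_outside: "r > 0 \<Longrightarrow> y \<notin> cball x r \<Longrightarrow> bump x r y = 0"
  using power_strict_mono[of r "dist x y" 2]
  by (simp add: bump_def flat_def dist_norm norm_minus_commute dot_square_norm)

lemma smooth_on_bump: 
  fixes x :: "'a::euclidean_space"
  shows "smooth_on UNIV (bump x r)"
  unfolding smooth_on_def
proof
  fix k
  have q: "Ck_on k UNIV (\<lambda>y::'a. r\<^sup>2 + (- 1) * (\<Sum>b\<in>Basis. ((y + - x) \<bullet> b) * ((y + - x) \<bullet> b)))"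
    by (intro Ck_on_add Ck_on_sum Ck_on_mult Ck_on_inner Ck_on_const Ck_on_id open_UNIV)
  have "bump x r = (\<lambda>y. flat 0 (r\<^sup>2 + (- 1) * (\<Sum>b\<in>Basis. ((y + - x) \<bullet> b) * ((y + - x) \<bullet> b))))"
    by (subst euclidean_inner[symmetric]) (simp add: bump_def fun_eq_iff)
  then show "Ck_on k UNIV (bump x r)"
    using Ck_on_compose[OF open_UNIV _ Ck_on_flat q] by simp
qed

section \<open>Smooth functions and tangent vectors in charts\<close>

text \<open>The tangent vector at \<open>p\<close> whose coordinates in the chart \<open>(U, \<phi>)\<close> are \<open>w\<close>.\<close>
definition chart_vec ::
  "('a, 'n::finite) atlas \<Rightarrow> 'a set \<Rightarrow> ('a \<Rightarrow> real ^ 'n) \<Rightarrow> 'a \<Rightarrow> real ^ 'n \<Rightarrow> 'a tvec" where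
  "chart_vec A U \<phi> p w =
     (\<lambda>f. if smooth_fun A f then frechet_derivative (f \<circ> inv_into U \<phi>) (at (\<phi> p)) w else 0)"

lemma smooth_atlas_chart:
  assumes "smooth_atlas A" "(U, \<phi>) \<in> A"
  shows "open U" "open (\<phi> ` U)" "homeomorphism U (\<phi> ` U) \<phi> (inv_into U \<phi>)" "inj_on \<phi> U"
proof -
  show "open U" "open (\<phi> ` U)" and hom: "homeomorphism U (\<phi> ` U) \<phi> (inv_into U \<phi>)"
    using assms unfolding smooth_atlas_def by auto
  show "inj_on \<phi> U"
    using hom by (metis homeomorphism_apply1 inj_on_inverseI)
qed

lemma chart_image_open:
  assumes "smooth_atlas A" "(U, \<phi>) \<in> A" "open W" "W \<subseteq> U"
  shows "open (\<phi> ` W)"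
proof -
  note c = smooth_atlas_chart[OF assms(1,2)]
  have "openin (top_of_set (\<phi> ` U)) (\<phi> ` W)"
    using homeomorphism_imp_open_map[OF c(3)] assms(3,4) by (simp add: open_openin_trans openin_open_eq c(1))
  then show ?thesis using c(2) by (simp add: openin_open_eq)
qed

lemma chart_covers:
  assumes "smooth_atlas A"
  obtains U \<phi> where "(U, \<phi>) \<in> A" "p \<in> U"
proof -
  have "p \<in> (\<Union>(U, \<phi>)\<in>A. U)" using assms unfolding smooth_atlas_def by simp
  then show thesis using that by auto
qed

lemma smooth_on_transition:
  assumes "smooth_atlas A" "(U, \<phi>) \<in> A" "(V, \<psi>) \<in> A"
  shows "smooth_on (\<psi> ` (U \<inter> V)) (\<phi> \<circ> inv_into V \<psi>)"
  using assms unfolding smooth_atlas_def by (fastforce simp: Int_commute)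

lemma smooth_fun_chart:
  "smooth_fun A f \<Longrightarrow> (U, \<phi>) \<in> A \<Longrightarrow> smooth_on (\<phi> ` U) (f \<circ> inv_into U \<phi>)"
  unfolding smooth_fun_def by auto

lemma smooth_fun_has_derivative:
  assumes "smooth_fun A f" "(U, \<phi>) \<in> A" "p \<in> U"
  shows "((f \<circ> inv_into U \<phi>) has_derivative frechet_derivative (f \<circ> inv_into U \<phi>) (at (\<phi> p))) (at (\<phi> p))"
  using smooth_fun_chart[OF assms(1,2)] assms(3) unfolding smooth_on_def
  by (intro Ck_on_differentiable[of 0 "\<phi> ` U"]) auto

lemma smooth_fun_const: "smooth_fun A (\<lambda>_. c)"
  unfolding smooth_fun_def smooth_on_def by (auto simp: comp_def intro: Ck_on_const)

lemma smooth_fun_add: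
  assumes "smooth_atlas A" "smooth_fun A f" "smooth_fun A h"
  shows "smooth_fun A (\<lambda>p. f p + h p)"
  unfolding smooth_fun_def
proof safe
  fix U \<phi> assume U: "(U, \<phi>) \<in> A"
  note s = assms(2,3)[THEN smooth_fun_chart, OF U]
  show "smooth_on (\<phi> ` U) ((\<lambda>p. f p + h p) \<circ> inv_into U \<phi>)"
    using s Ck_on_add[OF smooth_atlas_chart(2)[OF assms(1) U]]
    unfolding smooth_on_def comp_def by blast
qed

lemma smooth_fun_mult:
  assumes "smooth_atlas A" "smooth_fun A f" "smooth_fun A h"
  shows "smooth_fun A (\<lambda>p. f p * h p)"
  unfolding smooth_fun_def
proof safe
  fix U \<phi> assume U: "(U, \<phi>) \<in> A"
  note s = assms(2,3)[THEN smooth_fun_chart, OF U]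
  show "smooth_on (\<phi> ` U) ((\<lambda>p. f p * h p) \<circ> inv_into U \<phi>)"
    using s Ck_on_mult[OF smooth_atlas_chart(2)[OF assms(1) U]]
    unfolding smooth_on_def comp_def by blast
qed

text \<open>The support of the extension is the image of \<open>K\<close> in the manifold, which is compact and hence, by
  the Hausdorff property, closed. Off this image the function is locally zero, and on \<open>U\<close> it is
  smooth in every other chart because the transition maps are smooth. This is the only way in which
  global objects are produced from local ones.\<close>
lemma smooth_fun_extend_by_zero:
  assumes A: "smooth_atlas A" and U: "(U, \<phi>) \<in> A"
    and u: "smooth_on (\<phi> ` U) u"
    and K: "compact K" "K \<subseteq> \<phi> ` U" "\<And>x. x \<in> \<phi> ` U \<Longrightarrow> x \<notin> K \<Longrightarrow> u x = 0"
  shows "smooth_fun A (\<lambda>q. if q \<in> U then u (\<phi> q) else 0)" (is "smooth_fun A ?F")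
  unfolding smooth_fun_def
proof safe
  fix V \<psi> assume V: "(V, \<psi>) \<in> A"
  note cU = smooth_atlas_chart[OF A U] and cV = smooth_atlas_chart[OF A V]
  define L where "L = inv_into U \<phi> ` K"
  have "compact L"
    unfolding L_def using K(1,2) cU(3)
    by (intro compact_continuous_image) (auto simp: homeomorphism_def intro: continuous_on_subset)
  then have L: "closed L" by (rule compact_imp_closed)
  show "smooth_on (\<psi> ` V) (?F \<circ> inv_into V \<psi>)"
    unfolding smooth_on_def
  proof (rule allI, rule Ck_on_local)
    fix k x assume "x \<in> \<psi> ` V"
    then obtain q where q: "q \<in> V" "x = \<psi> q" by auto
    show "\<exists>T. open T \<and> x \<in> T \<and> Ck_on k T (?F \<circ> inv_into V \<psi>)"
    proof (cases "q \<in> U")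
      case True
      let ?T = "\<psi> ` (U \<inter> V)"
      have T: "open ?T" using cU(1) cV(1) by (intro chart_image_open[OF A V]) auto
      have "Ck_on k ?T (\<lambda>y. u ((\<phi> \<circ> inv_into V \<psi>) y))"
      proof (rule Ck_on_compose[where f = u and T = "\<phi> ` U", OF T])
        show "(\<phi> \<circ> inv_into V \<psi>) ` ?T \<subseteq> \<phi> ` U"
          using cV(4) by auto
      qed (use u smooth_on_transition[OF A U V] in \<open>auto simp: smooth_on_def comp_def\<close>)
      then have "Ck_on k ?T (?F \<circ> inv_into V \<psi>)"
        by (rule Ck_on_cong[OF T, rotated]) (use cV(4) in auto)
      then show ?thesis using T True q by blast
    next
      case False
      let ?T = "\<psi> ` (V - L)"
      have T: "open ?T" using cV(1) L by (intro chart_image_open[OF A V]) auto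
      have "L \<subseteq> U" using K(2) unfolding L_def by (auto intro: inv_into_into)
      have "u (\<phi> p) = 0" if "p \<in> V - L" "p \<in> U" for p
      proof -
        have "\<phi> p \<notin> K" using that cU(4) unfolding L_def by (metis DiffD2 image_eqI inv_into_f_f)
        then show ?thesis using K(3) that(2) by simp
      qed
      then have "Ck_on k ?T (?F \<circ> inv_into V \<psi>)"
        using cV(4) by (intro Ck_on_cong[OF T _ Ck_on_const[of k ?T 0]]) auto
      then show ?thesis using T False q \<open>L \<subseteq> U\<close> by blast
    qed
  qed
qed

text \<open>The chain rule for the transition map. It makes every chart around \<open>p\<close> describe the whole tangent
  space, which is why sums of tangent vectors coming from different charts stay tangent.\<close>
lemma chart_vec_transition:
  assumes A: "smooth_atlas A" and U: "(U, \<phi>) \<in> A" and V: "(V, \<psi>) \<in> A" and p: "p \<in> U" "p \<in> V"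
  shows "chart_vec A V \<psi> p w
    = chart_vec A U \<phi> p (frechet_derivative (\<phi> \<circ> inv_into V \<psi>) (at (\<psi> p)) w)"
proof -
  note cU = smooth_atlas_chart[OF A U] and cV = smooth_atlas_chart[OF A V]
  let ?T = "\<psi> ` (U \<inter> V)"
  let ?t = "\<phi> \<circ> inv_into V \<psi>"
  have T: "open ?T" using cU(1) cV(1) by (intro chart_image_open[OF A V]) auto
  have x: "\<psi> p \<in> ?T" using p by auto
  have t: "(?t has_derivative frechet_derivative ?t (at (\<psi> p))) (at (\<psi> p))"
    using smooth_on_transition[OF A U V] x unfolding smooth_on_def
    by (intro Ck_on_differentiable[of 0 ?T]) auto
  have "frechet_derivative (f \<circ> inv_into V \<psi>) (at (\<psi> p)) w
      = frechet_derivative (f \<circ> inv_into U \<phi>) (at (\<phi> p)) (frechet_derivative ?t (at (\<psi> p)) w)"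
    if f: "smooth_fun A f" for f
  proof -
    have tp: "?t (\<psi> p) = \<phi> p" using p cV(4) by simp
    have "((\<lambda>y. (f \<circ> inv_into U \<phi>) (?t y)) has_derivative
        (\<lambda>w. frechet_derivative (f \<circ> inv_into U \<phi>) (at (\<phi> p)) (frechet_derivative ?t (at (\<psi> p)) w)))
        (at (\<psi> p))"
      using has_derivative_compose[OF t] smooth_fun_has_derivative[OF f U p(1)] unfolding tp by blast
    then have "((f \<circ> inv_into V \<psi>) has_derivative
        (\<lambda>w. frechet_derivative (f \<circ> inv_into U \<phi>) (at (\<phi> p)) (frechet_derivative ?t (at (\<psi> p)) w)))
        (at (\<psi> p))"
      by (rule has_derivative_transform_within_open[OF _ T x]) (use cU(4) cV(4) in auto)
    from frechet_derivative_at[OF this] show ?thesis by metis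
  qed
  then show ?thesis unfolding chart_vec_def by auto
qed

lemma tangent_space_chart:
  assumes A: "smooth_atlas A" and U: "(U, \<phi>) \<in> A" and p: "p \<in> U"
  shows "tangent_space A p = range (chart_vec A U \<phi> p)"
proof
  show "range (chart_vec A U \<phi> p) \<subseteq> tangent_space A p"
    using U p unfolding tangent_space_def chart_vec_def by fastforce
  show "tangent_space A p \<subseteq> range (chart_vec A U \<phi> p)"
  proof
    fix v assume "v \<in> tangent_space A p"
    then obtain V \<psi> w where V: "(V, \<psi>) \<in> A" "p \<in> V" and v: "v = chart_vec A V \<psi> p w"
      unfolding tangent_space_def chart_vec_def by auto
    show "v \<in> range (chart_vec A U \<phi> p)"
      unfolding v chart_vec_transition[OF A U V(1) p V(2)] by simp
  qed
qed

lemma chart_vec_linear: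
  assumes "(U, \<phi>) \<in> A" "p \<in> U"
  shows "chart_vec A U \<phi> p (v + w) = chart_vec A U \<phi> p v + chart_vec A U \<phi> p w"
    and "chart_vec A U \<phi> p (c *\<^sub>R w) = c *\<^sub>t chart_vec A U \<phi> p w"
  using smooth_fun_has_derivative[OF _ assms, THEN has_derivative_linear]
  by (auto simp: chart_vec_def tscale_def fun_eq_iff linear_add linear_cmul)

lemma tangent_space_add:
  assumes "smooth_atlas A" "u \<in> tangent_space A p" "v \<in> tangent_space A p"
  shows "u + v \<in> tangent_space A p"
proof -
  obtain U \<phi> where U: "(U, \<phi>) \<in> A" "p \<in> U" using chart_covers[OF assms(1)] by blast
  show ?thesis using assms(2,3)
    by (auto simp: tangent_space_chart[OF assms(1) U] simp flip: chart_vec_linear(1)[OF U])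
qed

lemma tangent_space_scale:
  assumes "smooth_atlas A" "u \<in> tangent_space A p"
  shows "c *\<^sub>t u \<in> tangent_space A p"
proof -
  obtain U \<phi> where U: "(U, \<phi>) \<in> A" "p \<in> U" using chart_covers[OF assms(1)] by blast
  show ?thesis using assms(2)
    by (auto simp: tangent_space_chart[OF assms(1) U] simp flip: chart_vec_linear(2)[OF U])
qed

lemma vector_field_add:
  assumes "smooth_atlas A" "vector_field A X" "vector_field A Y"
  shows "vector_field A (X + Y)"
  using assms smooth_fun_add[OF assms(1)]
  by (auto simp: vector_field_def deriv_along_def tangent_space_add)

lemma vector_field_fscale:
  assumes "smooth_atlas A" "smooth_fun A h" "vector_field A X"
  shows "vector_field A (h *\<^sub>v X)"
  unfolding vector_field_def
proof (intro conjI allI impI)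
  show "(h *\<^sub>v X) p \<in> tangent_space A p" for p
    using assms(3) tangent_space_scale[OF assms(1)] by (simp add: vector_field_def fscale_def)
  show "smooth_fun A (deriv_along (h *\<^sub>v X) f)" if "smooth_fun A f" for f
    using assms(3) smooth_fun_mult[OF assms(1,2), of "deriv_along X f"] that
    by (simp add: vector_field_def deriv_along_def fscale_def tscale_def)
qed

section \<open>Vector fields with prescribed values and bases of tangent spaces\<close>

text \<open>Take the vector field with constant coordinates in a chart, multiply it by a bump function
  and extend it by zero. It links the parallelism conditions, which quantify over global vector
  fields, with linear algebra in a single tangent space.\<close>
lemma tangent_vector_extends:
  assumes A: "smooth_atlas A" and v: "v \<in> tangent_space A p"
  obtains X where "vector_field A X" "X p = v"
proof -
  obtain U \<phi> where U: "(U, \<phi>) \<in> A" "p \<in> U" using chart_covers[OF A] by blast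
  note cU = smooth_atlas_chart[OF A U(1)]
  obtain w where w: "v = chart_vec A U \<phi> p w"
    using v unfolding tangent_space_chart[OF A U] by auto
  obtain r where r: "r > 0" "cball (\<phi> p) r \<subseteq> \<phi> ` U"
    using cU(2) U(2) by (meson image_eqI open_contains_cball)
  let ?b = "bump (\<phi> p) r"
  \<comment> \<open>The bump function is divided by its value at the centre, so that X takes the value v at p.\<close>
  define X where "X = (\<lambda>q. if q \<in> U then (?b (\<phi> q) / ?b (\<phi> p)) *\<^sub>t chart_vec A U \<phi> q w else 0)"
  have "vector_field A X"
    unfolding vector_field_def
  proof (intro conjI allI impI)
    fix q
    obtain V \<psi> where V: "(V, \<psi>) \<in> A" "q \<in> V" using chart_covers[OF A] by blast
    have "0 *\<^sub>t chart_vec A V \<psi> q 0 \<in> tangent_space A q"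
      by (intro tangent_space_scale[OF A]) (simp add: tangent_space_chart[OF A V])
    then have "0 \<in> tangent_space A q" by (simp add: tscale_def zero_fun_def)
    then show "X q \<in> tangent_space A q"
      using tangent_space_chart[OF A U(1), of q] by (auto simp: X_def intro!: tangent_space_scale[OF A])
  next
    fix f assume f: "smooth_fun A f"
    let ?u = "\<lambda>x. ?b x * (inverse (?b (\<phi> p)) * frechet_derivative (f \<circ> inv_into U \<phi>) (at x) w)"
    have su: "smooth_on (\<phi> ` U) ?u"
      unfolding smooth_on_def
    proof
      fix k
      have "Ck_on (Suc k) (\<phi> ` U) (f \<circ> inv_into U \<phi>)"
        using smooth_fun_chart[OF f U(1)] unfolding smooth_on_def by blast
      then have "Ck_on k (\<phi> ` U) (\<lambda>x. frechet_derivative (f \<circ> inv_into U \<phi>) (at x) w)"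
        by simp
      moreover have "Ck_on k (\<phi> ` U) ?b"
        using smooth_on_bump Ck_on_subset unfolding smooth_on_def by blast
      ultimately show "Ck_on k (\<phi> ` U) ?u"
        by (intro Ck_on_mult Ck_on_const cU(2))
    qed
    have "smooth_fun A (\<lambda>q. if q \<in> U then ?u (\<phi> q) else 0)"
      using r bump_outside[OF r(1)]
      by (intro smooth_fun_extend_by_zero[OF A U(1) su, where K = "cball (\<phi> p) r"]) auto
    moreover have "deriv_along X f = (\<lambda>q. if q \<in> U then ?u (\<phi> q) else 0)"
      using f by (auto simp: deriv_along_def X_def tscale_def chart_vec_def fun_eq_iff divide_inverse)
    ultimately show "smooth_fun A (deriv_along X f)" by simp
  qed
  moreover have "X p = v"
    using U(2) bump_center[OF r(1), of "\<phi> p"] by (simp add: X_def w tscale_def)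
  ultimately show thesis using that by blast
qed

text \<open>Tangent vectors are tested only on globally smooth functions, so the coordinate functions
  must first be cut off. Multiplying \<open>\<phi>\<^sub>j - \<phi>\<^sub>j(p)\<close> by a bump function suffices: since
  this difference vanishes at \<open>p\<close>, the derivative of the product there is \<open>\<phi>\<^sub>j\<close>'s derivative times
  the nonzero value of the bump function, whatever the derivative of the bump function is.\<close>
lemma inj_chart_vec:
  fixes A :: "('a::{second_countable_topology, t2_space}, 'n::finite) atlas"
  assumes A: "smooth_atlas A" and U: "(U, \<phi>) \<in> A" "p \<in> U"
  shows "inj (chart_vec A U \<phi> p)"
proof (rule injI)
  fix v w :: "real ^ 'n" assume eq: "chart_vec A U \<phi> p v = chart_vec A U \<phi> p w"
  note cU = smooth_atlas_chart[OF A U(1)]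
  obtain r where r: "r > 0" "cball (\<phi> p) r \<subseteq> \<phi> ` U"
    using cU(2) U(2) by (meson image_eqI open_contains_cball)
  let ?b = "bump (\<phi> p) r"
  show "v = w"
  proof (rule vec_eq_iff[THEN iffD2, rule_format])
    fix j
    let ?u = "\<lambda>x. ?b x * ((x + - \<phi> p) \<bullet> axis j 1)"
    let ?f = "\<lambda>q. if q \<in> U then ?u (\<phi> q) else 0"
    have b: "Ck_on k (\<phi> ` U) ?b" for k
      using smooth_on_bump Ck_on_subset unfolding smooth_on_def by blast
    have su: "smooth_on (\<phi> ` U) ?u"
      unfolding smooth_on_def
      by (intro allI Ck_on_mult b Ck_on_inner Ck_on_add Ck_on_id Ck_on_const cU(2))
    have f: "smooth_fun A ?f"
      using r bump_outside[OF r(1)]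
      by (intro smooth_fun_extend_by_zero[OF A U(1) su, where K = "cball (\<phi> p) r"]) auto
    have px: "\<phi> p \<in> \<phi> ` U" using U(2) by simp
    have bd: "(?b has_derivative frechet_derivative ?b (at (\<phi> p))) (at (\<phi> p))"
      by (rule Ck_on_differentiable[OF b px])
    have "(?u has_derivative (\<lambda>h. ?b (\<phi> p) * (h \<bullet> axis j 1))) (at (\<phi> p))"
      by (rule derivative_eq_intros bd refl | simp)+
    then have "((?f \<circ> inv_into U \<phi>) has_derivative (\<lambda>h. ?b (\<phi> p) * (h \<bullet> axis j 1))) (at (\<phi> p))"
      by (rule has_derivative_transform_within_open[OF _ cU(2) px]) (use cU(4) in auto)
    then have d: "(\<lambda>h. ?b (\<phi> p) * (h \<bullet> axis j 1)) = frechet_derivative (?f \<circ> inv_into U \<phi>) (at (\<phi> p))"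
      by (rule frechet_derivative_at)
    have "chart_vec A U \<phi> p h ?f = ?b (\<phi> p) * (h \<bullet> axis j 1)" for h
      using f fun_cong[OF d, of h] by (simp add: chart_vec_def)
    from this[of v] this[of w] have "?b (\<phi> p) * (v \<bullet> axis j 1) = ?b (\<phi> p) * (w \<bullet> axis j 1)"
      unfolding eq by (rule trans[OF sym])
    then show "v $ j = w $ j"
      using bump_center[OF r(1), of "\<phi> p"] by (simp add: inner_axis)
  qed
qed

lemma chart_vec_sum:
  assumes "(U, \<phi>) \<in> A" "p \<in> U"
  shows "(\<Sum>i\<in>UNIV. (c $ i) *\<^sub>t chart_vec A U \<phi> p (axis i 1)) = chart_vec A U \<phi> p c"
proof -
  have z: "chart_vec A U \<phi> p 0 = 0"
    using chart_vec_linear(2)[OF assms, of 0 0] by (simp add: tscale_def zero_fun_def)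
  have lin: "chart_vec A U \<phi> p (\<Sum>i\<in>I. (c $ i) *\<^sub>R axis i 1)
      = (\<Sum>i\<in>I. (c $ i) *\<^sub>t chart_vec A U \<phi> p (axis i 1))" if "finite I" for I
    using that by induction (simp_all add: z chart_vec_linear[OF assms])
  have "(\<Sum>i\<in>UNIV. (c $ i) *\<^sub>R axis i 1) = c"
    using basis_expansion[of c] by (simp add: scalar_mult_eq_scaleR)
  with lin[OF finite, of UNIV, symmetric] show ?thesis by (simp only:)
qed

lemma tangent_basis_exists:
  fixes A :: "('a::{second_countable_topology, t2_space}, 'n::finite) atlas"
  assumes A: "smooth_atlas A"
  obtains e where "tangent_basis A p e"
proof -
  obtain U \<phi> where U: "(U, \<phi>) \<in> A" "p \<in> U" using chart_covers[OF A] by blast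
  have "tangent_basis A p (\<lambda>i. chart_vec A U \<phi> p (axis i 1))"
    using inj_chart_vec[OF A U]
    by (auto simp: tangent_basis_def chart_vec_sum[OF U] tangent_space_chart[OF A U] dest: injD)
  then show thesis using that by blast
qed

text \<open>In a basis, multiplication by \<open>c\<close> has the matrix \<open>c\<close> times the identity, of trace
  \<open>c\<close> times the dimension, and the dimension is positive.\<close>
lemma traceless_scalar_imp_zero:
  fixes A :: "('a::{second_countable_topology, t2_space}, 'n::finite) atlas"
  assumes A: "smooth_atlas A" and "traceless A P"
    and s: "\<And>v. v \<in> tangent_space A p \<Longrightarrow> P p v = c *\<^sub>t v"
  shows "c = 0"
proof -
  obtain e where e: "tangent_basis A p e" using tangent_basis_exists[OF A] by blast
  have "P p (e j) = (\<Sum>i\<in>UNIV. (mat c $ i $ j) *\<^sub>t e i)" for j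
  proof -
    have "(\<Sum>i\<in>UNIV. (mat c $ i $ j) *\<^sub>t e i) = (\<Sum>i\<in>UNIV. if i = j then c *\<^sub>t e i else 0)"
      by (rule sum.cong) (auto simp: mat_def tscale_def zero_fun_def)
    then show ?thesis using s e by (simp add: tangent_basis_def)
  qed
  then have "trace (mat c :: real ^ 'n ^ 'n) = 0"
    using assms(2) e unfolding traceless_def by blast
  then show ?thesis by (simp add: trace_def mat_def)
qed

lemma tangent_space_derivation_linear:
  assumes A: "smooth_atlas A" and v: "v \<in> tangent_space A p"
    and f: "smooth_fun A f" and h: "smooth_fun A h"
  shows "v (\<lambda>q. r * f q + s * h q) = r * v f + s * v h"
proof -
  obtain U \<phi> where U: "(U, \<phi>) \<in> A" "p \<in> U" using chart_covers[OF A] by blast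
  obtain w where w: "v = chart_vec A U \<phi> p w"
    using v unfolding tangent_space_chart[OF A U] by auto
  let ?f = "\<lambda>q. r * f q + s * h q"
  let ?d = "\<lambda>f. frechet_derivative (f \<circ> inv_into U \<phi>) (at (\<phi> p))"
  have smooth: "smooth_fun A ?f"
    by (intro smooth_fun_add smooth_fun_mult smooth_fun_const A f h)
  have "((\<lambda>x. r * (f \<circ> inv_into U \<phi>) x + s * (h \<circ> inv_into U \<phi>) x) has_derivative
      (\<lambda>w. r * ?d f w + s * ?d h w)) (at (\<phi> p))"
    by (intro has_derivative_add has_derivative_mult_right
        smooth_fun_has_derivative[OF f U] smooth_fun_has_derivative[OF h U])
  then have "((?f \<circ> inv_into U \<phi>) has_derivative (\<lambda>w. r * ?d f w + s * ?d h w)) (at (\<phi> p))"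
    by (simp add: comp_def)
  then have "(\<lambda>w. r * ?d f w + s * ?d h w) = ?d ?f"
    by (rule frechet_derivative_at)
  from fun_cong[OF this, of w] show ?thesis
    using smooth f h by (simp add: w chart_vec_def)
qed

section \<open>The torsion of a connection of the family\<close>

text \<open>The torsion of the connections of the family, as an expression in an arbitrary form \<open>\<theta>\<close>. This
  generality matters: the covariant derivative of the torsion is the same expression in the covariant
  derivative of \<open>\<theta>\<close>. The minus signs sit in the coefficients so that the whole is a sum of
  multiples of vector fields, to which the rules of a linear connection apply term by term.\<close>
definition W1_torsion ::
  "'a endo \<Rightarrow> nat \<Rightarrow> real \<Rightarrow> real \<Rightarrow> ('a vfield \<Rightarrow> 'a \<Rightarrow> real) \<Rightarrow> 'a vfield \<Rightarrow> 'a vfield \<Rightarrow> 'a vfield" where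
  "W1_torsion P n a b \<theta> X Y =
     (let c = b + 1 / (2 * real n) in
      (\<lambda>p. a * \<theta> (app P X) p + b * \<theta> X p) *\<^sub>v app P Y
      + (\<lambda>p. a * \<theta> X p + c * \<theta> (app P X) p) *\<^sub>v Y
      + (\<lambda>p. (- a) * \<theta> (app P Y) p + (- b) * \<theta> Y p) *\<^sub>v app P X
      + (\<lambda>p. (- a) * \<theta> Y p + (- c) * \<theta> (app P Y) p) *\<^sub>v X)"

lemma riemannian_almost_product_manifoldD:
  assumes "riemannian_almost_product_manifold A P g"
  shows "smooth_atlas A" "riemannian_metric A g" "endo_field A P" "traceless A P"
    and "u \<in> tangent_space A p \<Longrightarrow> P p (P p u) = u"
    and "u \<in> tangent_space A p \<Longrightarrow> v \<in> tangent_space A p \<Longrightarrow> g p (P p u) (P p v) = g p u v"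
  using assms unfolding riemannian_almost_product_manifold_def by blast+

lemma vector_field_tangent: "vector_field A X \<Longrightarrow> X p \<in> tangent_space A p"
  by (simp add: vector_field_def)

lemma app_vector_field: "endo_field A P \<Longrightarrow> vector_field A X \<Longrightarrow> vector_field A (app P X)"
  by (simp add: endo_field_def)

lemma app_app:
  assumes "riemannian_almost_product_manifold A P g" "vector_field A X"
  shows "app P (app P X) = X"
  using riemannian_almost_product_manifoldD(5)[OF assms(1) vector_field_tangent[OF assms(2)]]
  by (simp add: app_def)

lemma pair_app_commute:
  assumes M: "riemannian_almost_product_manifold A P g"
    and X: "vector_field A X" and Y: "vector_field A Y"
  shows "pair g X (app P Y) = pair g Y (app P X)"
proof
  fix p
  note D = riemannian_almost_product_manifoldD[OF M]
  note t = vector_field_tangent[OF X, of p] vector_field_tangent[OF Y, of p]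
  have P: "P p (X p) \<in> tangent_space A p" "P p (Y p) \<in> tangent_space A p"
    using D(3) t by (auto simp: endo_field_def)
  have "g p (X p) (P p (Y p)) = g p (P p (X p)) (P p (P p (Y p)))"
    using D(6)[OF t(1) P(2)] by simp
  also have "\<dots> = g p (P p (X p)) (Y p)"
    using D(5)[OF t(2)] by simp
  also have "\<dots> = g p (Y p) (P p (X p))"
    using D(2) P(1) t(2) unfolding riemannian_metric_def by blast
  finally show "pair g X (app P Y) p = pair g Y (app P X) p"
    by (simp add: pair_def app_def)
qed

lemma pair_commute:
  assumes "riemannian_metric A g" "vector_field A X" "vector_field A Y"
  shows "pair g X Y = pair g Y X"
  using assms vector_field_tangent[OF assms(2)] vector_field_tangent[OF assms(3)]
  unfolding riemannian_metric_def pair_def by blast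

text \<open>The Levi-Civita connection contributes no torsion, and the terms of the family with coefficients
  \<open>g(X, Y)\<close> and \<open>g(X, P Y)\<close> are symmetric in \<open>X\<close> and \<open>Y\<close>, hence cancel.\<close>
lemma torsion_family_connection:
  assumes M: "riemannian_almost_product_manifold A P g" and D: "levi_civita A g D"
    and D': "\<And>X Y. vector_field A X \<Longrightarrow> vector_field A Y \<Longrightarrow>
           D' X Y = family_connection P g D n \<theta> \<Omega> a b X Y"
    and X: "vector_field A X" and Y: "vector_field A Y"
  shows "torsion A D' X Y = W1_torsion P n a b \<theta> X Y"
proof -
  have "torsion A D X Y = 0"
    using D X Y unfolding levi_civita_def by blast
  then have *: "lie_bracket A X Y = D X Y - D Y X"
    by (simp add: torsion_def)
  note g = pair_app_commute[OF M Y X] pair_commute[OF riemannian_almost_product_manifoldD(2)[OF M] Y X]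
  show ?thesis
    unfolding torsion_def * D'[OF X Y] D'[OF Y X] family_connection_def W1_torsion_def Let_def g
    by (simp add: fun_eq_iff fscale_def tscale_def algebra_simps)
qed

text \<open>The torsion is built from \<open>\<theta>\<close>, \<open>P\<close> and the identity, of which only \<open>\<theta>\<close> need not be parallel.
  By the Leibniz rule its covariant derivative is therefore obtained by replacing \<open>\<theta>\<close> by its
  covariant derivative.\<close>
lemma cov_W1_torsion:
  assumes A: "smooth_atlas A" and D: "linear_connection A D"
    and P: "endo_field A P" "parallel_endo A D P"
    and \<theta>: "\<And>X. vector_field A X \<Longrightarrow> smooth_fun A (\<theta> X)"
    and W: "vector_field A W" and X: "vector_field A X" and Y: "vector_field A Y"
  shows "cov_tensor12 D (W1_torsion P n a b \<theta>) W X Y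
    = W1_torsion P n a b (cov_form D \<theta> W) X Y"
proof -
  note PX = app_vector_field[OF P(1) X] and PY = app_vector_field[OF P(1) Y]
  have DP: "app P (D W Z) = D W (app P Z)" if "vector_field A Z" for Z
    using P(2) W that unfolding parallel_endo_def cov_endo_def by simp
  have dl: "deriv_along W (\<lambda>q. r * f q + s * h q) = (\<lambda>p. r * deriv_along W f p + s * deriv_along W h p)"
    if "smooth_fun A f" "smooth_fun A h" for r s f h
    unfolding deriv_along_def
    using tangent_space_derivation_linear[OF A vector_field_tangent[OF W] that] by simp
  have sm: "smooth_fun A (\<lambda>p. r * \<theta> Z p + s * \<theta> Z' p)"
    if "vector_field A Z" "vector_field A Z'" for r s Z Z'
    using that by (intro smooth_fun_add smooth_fun_mult smooth_fun_const \<theta> A)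
  have Dadd: "D W (Z + Z') = D W Z + D W Z'" if "vector_field A Z" "vector_field A Z'" for Z Z'
    using D W that smooth_fun_const[of A 0] unfolding linear_connection_def by blast
  have Dscale: "D W (f *\<^sub>v Z) = deriv_along W f *\<^sub>v Z + f *\<^sub>v D W Z"
    if "smooth_fun A f" "vector_field A Z" for f Z
    using D W that unfolding linear_connection_def by blast
  have expand: "D W (f1 *\<^sub>v Z1 + f2 *\<^sub>v Z2 + f3 *\<^sub>v Z3 + f4 *\<^sub>v Z4)
      = (deriv_along W f1 *\<^sub>v Z1 + f1 *\<^sub>v D W Z1) + (deriv_along W f2 *\<^sub>v Z2 + f2 *\<^sub>v D W Z2)
      + (deriv_along W f3 *\<^sub>v Z3 + f3 *\<^sub>v D W Z3) + (deriv_along W f4 *\<^sub>v Z4 + f4 *\<^sub>v D W Z4)"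
    if "smooth_fun A f1" "vector_field A Z1" "smooth_fun A f2" "vector_field A Z2"
      "smooth_fun A f3" "vector_field A Z3" "smooth_fun A f4" "vector_field A Z4"
    for f1 f2 f3 f4 Z1 Z2 Z3 Z4
    by (simp add: Dadd Dscale vector_field_add[OF A] vector_field_fscale[OF A] that)
  show ?thesis
    unfolding cov_tensor12_def W1_torsion_def Let_def DP[OF X] DP[OF Y]
      expand[OF sm[OF PX X] PY sm[OF X PX] Y sm[OF PY Y] PX sm[OF Y PY] X]
      dl[OF \<theta>[OF PX] \<theta>[OF X]] dl[OF \<theta>[OF X] \<theta>[OF PX]]
      dl[OF \<theta>[OF PY] \<theta>[OF Y]] dl[OF \<theta>[OF Y] \<theta>[OF PY]]
    by (simp add: fun_eq_iff fscale_def tscale_def cov_form_def algebra_simps)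
qed

text \<open>For the torsion expression \<open>S\<close> of a form \<open>\<eta>\<close>, all terms of \<open>S(P X, Y) - P (S(X, Y))\<close> that
  contain \<open>X\<close> outside \<open>\<eta>\<close> cancel, and so do those with coefficient \<open>a\<close>. What remains is
  \<open>(c - b) {\<eta>(X) Y - \<eta>(P X) P Y}\<close> with \<open>c - b = 1/(2n)\<close>, a factor that is never zero, whatever
  the parameters \<open>a\<close> and \<open>b\<close> are.\<close>
lemma W1_torsion_zero_imp:
  assumes M: "riemannian_almost_product_manifold A P g" and n: "n > 0"
    and X: "vector_field A X" and Y: "vector_field A Y"
    and 1: "W1_torsion P n a b \<eta> X Y = 0" and 2: "W1_torsion P n a b \<eta> (app P X) Y = 0"
  shows "\<eta> X *\<^sub>v Y = \<eta> (app P X) *\<^sub>v app P Y"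
proof -
  note D = riemannian_almost_product_manifoldD[OF M]
  note t = vector_field_tangent[OF X] vector_field_tangent[OF Y]
  have P: "P p u \<in> tangent_space A p" if "u \<in> tangent_space A p" for p u
    using D(3) that by (auto simp: endo_field_def)
  have Padd: "P p (u + v) = P p u + P p v"
    if "u \<in> tangent_space A p" "v \<in> tangent_space A p" for p u v
    using D(3) that by (auto simp: endo_field_def)
  have Pscale: "P p (r *\<^sub>t u) = r *\<^sub>t P p u" if "u \<in> tangent_space A p" for p r u
    using D(3) that by (auto simp: endo_field_def)
  define c where "c = b + 1 / (2 * real n)"
  note T1 = 1[unfolded W1_torsion_def Let_def, folded c_def]
    and T2 = 2[unfolded W1_torsion_def Let_def app_app[OF M X], folded c_def]
  have "\<eta> X p * Y p f = \<eta> (app P X) p * P p (Y p) f" for p f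
  proof -
    let ?\<eta>X = "\<eta> X p" and ?\<eta>PX = "\<eta> (app P X) p" and ?\<eta>Y = "\<eta> Y p" and ?\<eta>PY = "\<eta> (app P Y) p"
    let ?T = "(a * ?\<eta>PX + b * ?\<eta>X) *\<^sub>t P p (Y p) + (a * ?\<eta>X + c * ?\<eta>PX) *\<^sub>t Y p
        + ((- a) * ?\<eta>PY + (- b) * ?\<eta>Y) *\<^sub>t P p (X p) + ((- a) * ?\<eta>Y + (- c) * ?\<eta>PY) *\<^sub>t X p"
    have T: "?T = 0"
      using fun_cong[OF T1, of p] by (simp add: app_def fscale_def)
    have "0 *\<^sub>t X p = (0 :: 'a tvec)" "0 *\<^sub>t P p (X p) = 0" by (simp_all add: tscale_def zero_fun_def)
    then have "P p ?T = 0"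
      unfolding T using Pscale[OF t(1), of p 0] by simp
    then have "((a * ?\<eta>PX + b * ?\<eta>X) *\<^sub>t Y p + (a * ?\<eta>X + c * ?\<eta>PX) *\<^sub>t P p (Y p)
        + ((- a) * ?\<eta>PY + (- b) * ?\<eta>Y) *\<^sub>t X p + ((- a) * ?\<eta>Y + (- c) * ?\<eta>PY) *\<^sub>t P p (X p)) f = 0"
      by (simp add: Padd Pscale P t tangent_space_add[OF D(1)] tangent_space_scale[OF D(1)] D(5))
    moreover have "((a * ?\<eta>X + b * ?\<eta>PX) *\<^sub>t P p (Y p) + (a * ?\<eta>PX + c * ?\<eta>X) *\<^sub>t Y p
        + ((- a) * ?\<eta>PY + (- b) * ?\<eta>Y) *\<^sub>t X p + ((- a) * ?\<eta>Y + (- c) * ?\<eta>PY) *\<^sub>t P p (X p)) f = 0"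
      using fun_cong[OF fun_cong[OF T2, of p], of f]
      by (simp add: app_def fscale_def)
    ultimately have "(c - b) * (?\<eta>X * Y p f) = (c - b) * (?\<eta>PX * P p (Y p) f)"
      by (simp add: tscale_def algebra_simps)
    moreover have "c - b \<noteq> 0" using n by (simp add: c_def)
    ultimately show ?thesis by simp
  qed
  then show ?thesis by (simp add: fun_eq_iff fscale_def tscale_def app_def)
qed

text \<open>If \<open>r\<close> were nonzero, \<open>P\<close> would be multiplication by \<open>s / r\<close> on the tangent space at \<open>p\<close>.
  Its trace vanishes, so \<open>s / r = 0\<close> and \<open>P = 0\<close> there, and \<open>P\<^sup>2 = 1\<close> makes the tangent space
  zero. This contradicts positive dimension.\<close>
lemma scaled_tangent_vectors_eq_imp_zero:
  assumes M: "riemannian_almost_product_manifold A P g"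
    and eq: "\<And>y. y \<in> tangent_space A p \<Longrightarrow> r *\<^sub>t y = s *\<^sub>t P p y"
  shows "r = 0"
proof (rule ccontr)
  assume r: "r \<noteq> 0"
  note D = riemannian_almost_product_manifoldD[OF M]
  have P: "P p y \<in> tangent_space A p" if "y \<in> tangent_space A p" for y
    using D(3) that by (auto simp: endo_field_def)
  have s: "P p y = (s / r) *\<^sub>t y" if y: "y \<in> tangent_space A p" for y
    using eq[OF P[OF y]] r by (simp add: D(5)[OF y] tscale_def fun_eq_iff field_simps)
  then have "s / r = 0"
    by (rule traceless_scalar_imp_zero[OF D(1) D(4)])
  then have "P p y = 0" if "y \<in> tangent_space A p" for y
    unfolding s[OF that] \<open>s / r = 0\<close> by (simp add: tscale_def zero_fun_def)
  then have "P p y = 1 *\<^sub>t y" if "y \<in> tangent_space A p" for y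
    using D(5)[OF that] P[OF that] that by (force simp: tscale_def)
  \<comment> \<open>On the zero space P is also multiplication by 1, which has nonzero trace.\<close>
  from traceless_scalar_imp_zero[OF D(1) D(4) this] show False by simp
qed

section \<open>Parallel torsion and parallel Lee form\<close>

theorem proposition5p1:
  fixes A :: "('a::{second_countable_topology, t2_space}, 'n::finite) atlas"
    and P :: "'a endo" and g :: "'a metric"
    and D D' :: "'a connection" and \<Omega> :: "'a vfield"
    and n :: nat and a b :: real
  assumes "W1_manifold A P g D n"
    and "dual_field A g (lee_form A P g D) \<Omega>"
    and "natural_connection A P g D'"
    and "\<forall>X Y. vector_field A X \<longrightarrow> vector_field A Y \<longrightarrow>
           D' X Y = family_connection P g D n (lee_form A P g D) \<Omega> a b X Y"
  shows "parallel_tensor12 A D' (torsion A D') \<longleftrightarrow> parallel_form A D' (lee_form A P g D)"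
proof -
  let ?\<theta> = "lee_form A P g D"
  let ?T = "W1_torsion P n a b"
  have M: "riemannian_almost_product_manifold A P g" and LC: "levi_civita A g D"
    and dim: "CARD('n) = 2 * n"
    using assms(1) unfolding W1_manifold_def by blast+
  have n: "n > 0" using dim zero_less_card_finite[where 'a = 'n] by linarith
  have D': "linear_connection A D'" "parallel_endo A D' P"
    using assms(3) unfolding natural_connection_def by blast+
  note R = riemannian_almost_product_manifoldD[OF M]
  have smooth: "smooth_fun A (?\<theta> X)" if "vector_field A X" for X
    using assms(2) R(2) that unfolding dual_field_def riemannian_metric_def by metis
  have T: "torsion A D' X Y = ?T ?\<theta> X Y" if "vector_field A X" "vector_field A Y" for X Y
    using assms(4) that by (intro torsion_family_connection[OF M LC]) auto
  have vf: "vector_field A (D' X Y)" if "vector_field A X" "vector_field A Y" for X Y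
    using D'(1) that smooth_fun_const[of A 0] unfolding linear_connection_def by blast
  have cov: "cov_tensor12 D' (torsion A D') W X Y = ?T (cov_form D' ?\<theta> W) X Y"
    if "vector_field A W" "vector_field A X" "vector_field A Y" for W X Y
    using cov_W1_torsion[OF R(1) D'(1) R(3) D'(2) smooth that]
    by (simp add: cov_tensor12_def T vf that)
  show ?thesis
  proof
    assume "parallel_form A D' ?\<theta>"
    then have "?T (cov_form D' ?\<theta> W) X Y = 0"
      if "vector_field A W" "vector_field A X" "vector_field A Y" for W X Y
      using that app_vector_field[OF R(3)]
      by (simp add: parallel_form_def W1_torsion_def Let_def fscale_def tscale_def zero_fun_def plus_fun_def)
    then show "parallel_tensor12 A D' (torsion A D')"
      by (simp add: parallel_tensor12_def cov)
  next
    assume par: "parallel_tensor12 A D' (torsion A D')"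
    have "cov_form D' ?\<theta> W X p = 0" if W: "vector_field A W" and X: "vector_field A X" for W X p
    proof (rule scaled_tangent_vectors_eq_imp_zero[OF M])
      let ?\<eta> = "cov_form D' ?\<theta> W"
      fix y assume "y \<in> tangent_space A p"
      then obtain Y where Y: "vector_field A Y" "Y p = y"
        using tangent_vector_extends[OF R(1)] by blast
      have "?T ?\<eta> Z Y = 0" if "vector_field A Z" for Z
        using par W Y(1) that by (simp add: parallel_tensor12_def flip: cov)
      then have "?\<eta> X *\<^sub>v Y = ?\<eta> (app P X) *\<^sub>v app P Y"
        using X app_vector_field[OF R(3) X] by (intro W1_torsion_zero_imp[OF M n X Y(1)]) auto
      from fun_cong[OF this, of p] show "?\<eta> X p *\<^sub>t y = ?\<eta> (app P X) p *\<^sub>t P p y"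
        by (simp add: fscale_def app_def Y(2))
    qed
    then show "parallel_form A D' ?\<theta>"
      by (simp add: parallel_form_def fun_eq_iff)
  qed
qed

end
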